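(* Let $V$ be an absolutely matrix ordered space, let $m,n\in\mathbb{N}$ and let $u,v\in M_{m,n}(V)$. (1) $u\perp v$ if and only if $\vert u\pm v\vert_{m,n} = \vert u\vert_{m,n} +\vert v\vert_{m,n}$ and $\vert u^*\pm v^*\vert_{n,m} = \vert u^*\vert_{n,m} +\vert v^*\vert_{n,m}$ (for both choices of sign). (2) If $u \perp v$, then $\left\vert \begin{bmatrix} u \\ v\end{bmatrix}\right\vert_{2m,n} = \vert u\vert_{m,n} + \vert v\vert_{m,n}$ and $\left\vert \begin{bmatrix} u & v\end{bmatrix}\right\vert_{m,2n} = \vert u\vert_{m,n} \oplus \vert v\vert_{m,n}$.
   Context: A real ordered vector space $(E,E^+)$ is a real vector space with a cone $E^+$ (closed under addition and multiplication by nonnegative scalars); $u \le v$ means $v-u \in E^+$. It is an absolutely ordered space if there is a map $\vert\cdot\vert : E \to E^+$ such that: (1) $\vert v\vert = v$ if $v \in E^+$; (2) $\vert v \vert \pm v \in E^+$ for all $v$; (3) $\vert kv\vert = \vert k\vert \vert v\vert$ for $k \in \mathbb{R}$; (4) if $\vert u-v\vert = u+v$ and $0 \le w \le v$, then $\vert u-w\vert = u+w$; (5) if $\vert u-v\vert = u+v$ and $\vert u-w\vert = u+w$, then $\vert u - \vert v\pm w\vert\vert = u + \vert v \pm w\vert$. In it, $u\perp v$ means $\vert\,\vert u\vert-\vert v\vert\,\vert = \vert u\vert+\vert v\vert$. For a $*$-vector space $V$ (complex vector space with conjugate-linear involution), $M_{m,n}(V)$ is the space of $m\times n$ matrices over $V$,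 $M_{m,n}=M_{m,n}(\mathbb{C})$ with the operator norm, $M_n(V)=M_{n,n}(V)$, $[v_{ij}]^*=[v_{ji}^*]$, $M_n(V)_{sa}$ is the set of self-adjoint elements, and $v\oplus w=\begin{bmatrix} v&0\\0&w\end{bmatrix}$. A matrix ordered space is a $*$-vector space $V$ with cones $M_n(V)^+\subset M_n(V)_{sa}$ ($n\in\mathbb{N}$) such that each $(M_n(V)_{sa},M_n(V)^+)$ is a real ordered vector space and $\alpha^*v\alpha\in M_m(V)^+$ for all $v\in M_n(V)^+$, $\alpha\in M_{n,m}$. An absolutely matrix ordered space is a matrix ordered space with maps $\vert\cdot\vert_{m,n}:M_{m,n}(V)\to M_n(V)^+$ (write $\vert\cdot\vert_n=\vert\cdot\vert_{n,n}$) such that: (i) each $(M_n(V)_{sa},M_n(V)^+,\vert\cdot\vert_n)$ is an absolutely ordered space; (ii) $\vert\alpha v\beta\vert_{r,s}\le\|\alpha\|\,\vert\,\vert v\vert_{m,n}\beta\vert_{n,s}$ for $v\in M_{m,n}(V)$, $\alpha\in M_{r,m}$, $\beta\in M_{n,s}$; (iii) $\vert v\oplus w\vert_{m+r,n+s}=\vert v\vert_{m,n}\oplus\vert w\vert_{r,s}$ for $v\in M_{m,n}(V)$, $w\in M_{r,s}(V)$. For $u,v\in M_{m,n}(V)$, $u\perp v$ means $\begin{bmatrix}0&u\\ u^*&0\end{bmatrix}\perp\begin{bmatrix}0&v\\ v^*&0\end{bmatrix}$ in $M_{m+n}(V)_{sa}$. *)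

theory Defs
  imports
    Complex_Main
    "HOL-Analysis.L2_Norm"
    "Jordan_Normal_Form.Matrix"
begin

section \<open>Absolutely ordered spaces\<close>

text \<open>The space is a carrier set \<open>E\<close> inside a type, so that the notion applies to the self-adjoint
  \<open>n \<times> n\<close> matrices for every \<open>n\<close>. Addition, subtraction and negation are those of the
  ambient type; nothing is assumed about them outside \<open>E\<close>.\<close>

locale real_vector_space_on =
  fixes E :: "'e :: {plus,minus,uminus} set"
    and zero :: 'e
    and smul :: "real \<Rightarrow> 'e \<Rightarrow> 'e"
  assumes zero_closed: "zero \<in> E"
    and add_closed: "u \<in> E \<Longrightarrow> v \<in> E \<Longrightarrow> u + v \<in> E"
    and uminus_closed: "u \<in> E \<Longrightarrow> - u \<in> E"
    and smul_closed: "u \<in> E \<Longrightarrow> smul k u \<in> E"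
    and add_assoc_on: "u \<in> E \<Longrightarrow> v \<in> E \<Longrightarrow> w \<in> E \<Longrightarrow> (u + v) + w = u + (v + w)"
    and add_commute_on: "u \<in> E \<Longrightarrow> v \<in> E \<Longrightarrow> u + v = v + u"
    and add_zero_on: "u \<in> E \<Longrightarrow> u + zero = u"
    and add_uminus_on: "u \<in> E \<Longrightarrow> u + (- u) = zero"
    and minus_on: "u \<in> E \<Longrightarrow> v \<in> E \<Longrightarrow> u - v = u + (- v)"
    and smul_add_right: "u \<in> E \<Longrightarrow> v \<in> E \<Longrightarrow> smul k (u + v) = smul k u + smul k v"
    and smul_add_left: "u \<in> E \<Longrightarrow> smul (k + l) u = smul k u + smul l u"
    and smul_smul: "u \<in> E \<Longrightarrow> smul k (smul l u) = smul (k * l) u"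
    and smul_one: "u \<in> E \<Longrightarrow> smul 1 u = u"

definition cone_le :: "'e :: minus set \<Rightarrow> 'e \<Rightarrow> 'e \<Rightarrow> bool" where
  "cone_le P u v \<longleftrightarrow> v - u \<in> P"

text \<open>A cone is nonempty, but it is not required to be proper.\<close>

locale real_ordered_vector_space = real_vector_space_on E zero smul
  for E :: "'e :: {plus,minus,uminus} set" and zero smul +
  fixes P :: "'e set"
  assumes cone_subset: "P \<subseteq> E"
    and cone_nonempty: "P \<noteq> {}"
    and cone_add: "u \<in> P \<Longrightarrow> v \<in> P \<Longrightarrow> u + v \<in> P"
    and cone_smul: "u \<in> P \<Longrightarrow> 0 \<le> k \<Longrightarrow> smul k u \<in> P"

locale absolutely_ordered_space = real_ordered_vector_space E zero smul P
  for E :: "'e :: {plus,minus,uminus} set" and zero smul P +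
  fixes absv :: "'e \<Rightarrow> 'e"
  assumes absv_in_cone: "v \<in> E \<Longrightarrow> absv v \<in> P"
    and absv_of_cone: "v \<in> P \<Longrightarrow> absv v = v"
    and absv_plus: "v \<in> E \<Longrightarrow> absv v + v \<in> P"
    and absv_minus: "v \<in> E \<Longrightarrow> absv v - v \<in> P"
    and absv_smul: "v \<in> E \<Longrightarrow> absv (smul k v) = smul \<bar>k\<bar> (absv v)"
    and absv_orth_mono: "u \<in> E \<Longrightarrow> v \<in> E \<Longrightarrow> w \<in> E \<Longrightarrow> absv (u - v) = u + v \<Longrightarrow>
      cone_le P zero w \<Longrightarrow> cone_le P w v \<Longrightarrow> absv (u - w) = u + w"
    and absv_orth_plus: "u \<in> E \<Longrightarrow> v \<in> E \<Longrightarrow> w \<in> E \<Longrightarrow> absv (u - v) = u + v \<Longrightarrow>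
      absv (u - w) = u + w \<Longrightarrow> absv (u - absv (v + w)) = u + absv (v + w)"
    and absv_orth_minus: "u \<in> E \<Longrightarrow> v \<in> E \<Longrightarrow> w \<in> E \<Longrightarrow> absv (u - v) = u + v \<Longrightarrow>
      absv (u - w) = u + w \<Longrightarrow> absv (u - absv (v - w)) = u + absv (v - w)"

definition orth :: "('e :: {plus,minus} \<Rightarrow> 'e) \<Rightarrow> 'e \<Rightarrow> 'e \<Rightarrow> bool" where
  "orth absv u v \<longleftrightarrow> absv (absv u - absv v) = absv u + absv v"


section \<open>Matrices over a complex vector space with involution\<close>

locale star_vector_space = vector_space scale
  for scale :: "complex \<Rightarrow> 'v \<Rightarrow> 'v :: ab_group_add" +
  fixes star :: "'v \<Rightarrow> 'v"
  assumes star_add: "star (x + y) = star x + star y"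
    and star_scale: "star (scale c x) = scale (cnj c) (star x)"
    and star_star: "star (star x) = x"

text \<open>Used both with the involution of the vector space and with \<^const>\<open>cnj\<close> for scalar matrices.\<close>

definition mat_star :: "('a \<Rightarrow> 'a) \<Rightarrow> 'a mat \<Rightarrow> 'a mat" where
  "mat_star star A = transpose_mat (map_mat star A)"

definition sa_mats :: "('v \<Rightarrow> 'v) \<Rightarrow> nat \<Rightarrow> 'v mat set" where
  "sa_mats star n = {A \<in> carrier_mat n n. mat_star star A = A}"

definition mat_rscale :: "(complex \<Rightarrow> 'v \<Rightarrow> 'v) \<Rightarrow> real \<Rightarrow> 'v mat \<Rightarrow> 'v mat" where
  "mat_rscale scale k A = map_mat (scale (complex_of_real k)) A"

definition mat_lmul ::
  "(complex \<Rightarrow> 'v \<Rightarrow> 'v :: comm_monoid_add) \<Rightarrow> complex mat \<Rightarrow> 'v mat \<Rightarrow> 'v mat" where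
  "mat_lmul scale \<alpha> A =
     mat (dim_row \<alpha>) (dim_col A) (\<lambda>(i, j). \<Sum>k<dim_row A. scale (\<alpha> $$ (i, k)) (A $$ (k, j)))"

definition mat_rmul ::
  "(complex \<Rightarrow> 'v \<Rightarrow> 'v :: comm_monoid_add) \<Rightarrow> 'v mat \<Rightarrow> complex mat \<Rightarrow> 'v mat" where
  "mat_rmul scale A \<beta> =
     mat (dim_row A) (dim_col \<beta>) (\<lambda>(i, j). \<Sum>k<dim_col A. scale (\<beta> $$ (k, j)) (A $$ (i, k)))"

definition vec_l2norm :: "complex vec \<Rightarrow> real" where
  "vec_l2norm x = L2_set (\<lambda>i. cmod (vec_index x i)) {..<dim_vec x}"

definition mat_opnorm :: "complex mat \<Rightarrow> real" where
  "mat_opnorm \<alpha> =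
     (SUP x \<in> {x \<in> carrier_vec (dim_col \<alpha>). vec_l2norm x \<le> 1}. vec_l2norm (\<alpha> *\<^sub>v x))"

definition mat_dsum :: "'v :: zero mat \<Rightarrow> 'v mat \<Rightarrow> 'v mat" where
  "mat_dsum A B =
     four_block_mat A (0\<^sub>m (dim_row A) (dim_col B)) (0\<^sub>m (dim_row B) (dim_col A)) B"

text \<open>The horizontal counterpart of \<^const>\<open>append_rows\<close>.\<close>

definition append_cols :: "'v :: zero mat \<Rightarrow> 'v mat \<Rightarrow> 'v mat" where
  "append_cols A B = four_block_mat A B (0\<^sub>m 0 (dim_col A)) (0\<^sub>m 0 (dim_col B))"


section \<open>Absolutely matrix ordered spaces\<close>

text \<open>\<open>P n\<close> is the cone of the \<open>n \<times> n\<close> matrices and \<open>absv m n\<close> the absolute value on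
  \<open>m \<times> n\<close> matrices. All sizes are positive; nothing is assumed about empty matrices.\<close>

locale matrix_ordered_space = star_vector_space scale star
  for scale :: "complex \<Rightarrow> 'v \<Rightarrow> 'v :: ab_group_add" and star +
  fixes P :: "nat \<Rightarrow> 'v mat set"
  assumes matrix_cone: "n \<ge> 1 \<Longrightarrow>
      real_ordered_vector_space (sa_mats star n) (0\<^sub>m n n) (mat_rscale scale) (P n)"
    and matrix_cone_conj: "m \<ge> 1 \<Longrightarrow> n \<ge> 1 \<Longrightarrow> A \<in> P n \<Longrightarrow> \<alpha> \<in> carrier_mat n m \<Longrightarrow>
      mat_rmul scale (mat_lmul scale (mat_star cnj \<alpha>) A) \<alpha> \<in> P m"

locale absolutely_matrix_ordered_space = matrix_ordered_space scale star P
  for scale :: "complex \<Rightarrow> 'v \<Rightarrow> 'v :: ab_group_add" and star P +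
  fixes absv :: "nat \<Rightarrow> nat \<Rightarrow> 'v mat \<Rightarrow> 'v mat"
  assumes absv_cone: "m \<ge> 1 \<Longrightarrow> n \<ge> 1 \<Longrightarrow> A \<in> carrier_mat m n \<Longrightarrow> absv m n A \<in> P n"
    and absv_square: "n \<ge> 1 \<Longrightarrow>
      absolutely_ordered_space (sa_mats star n) (0\<^sub>m n n) (mat_rscale scale) (P n) (absv n n)"
    and absv_mult: "m \<ge> 1 \<Longrightarrow> n \<ge> 1 \<Longrightarrow> r \<ge> 1 \<Longrightarrow> s \<ge> 1 \<Longrightarrow>
      A \<in> carrier_mat m n \<Longrightarrow> \<alpha> \<in> carrier_mat r m \<Longrightarrow> \<beta> \<in> carrier_mat n s \<Longrightarrow>
      cone_le (P s) (absv r s (mat_rmul scale (mat_lmul scale \<alpha> A) \<beta>))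
        (mat_rscale scale (mat_opnorm \<alpha>) (absv n s (mat_rmul scale (absv m n A) \<beta>)))"
    and absv_dsum: "m \<ge> 1 \<Longrightarrow> n \<ge> 1 \<Longrightarrow> r \<ge> 1 \<Longrightarrow> s \<ge> 1 \<Longrightarrow>
      A \<in> carrier_mat m n \<Longrightarrow> B \<in> carrier_mat r s \<Longrightarrow>
      absv (m + r) (n + s) (mat_dsum A B) = mat_dsum (absv m n A) (absv r s B)"

text \<open>The self-adjoint matrix \<open>[0, A; A*, 0]\<close>.\<close>

definition sa_dilation :: "('v \<Rightarrow> 'v) \<Rightarrow> 'v :: zero mat \<Rightarrow> 'v mat" where
  "sa_dilation star A =
     four_block_mat (0\<^sub>m (dim_row A) (dim_row A)) A (mat_star star A) (0\<^sub>m (dim_col A) (dim_col A))"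

definition mat_orth :: "('v \<Rightarrow> 'v) \<Rightarrow> (nat \<Rightarrow> nat \<Rightarrow> 'v mat \<Rightarrow> 'v mat) \<Rightarrow>
    nat \<Rightarrow> nat \<Rightarrow> 'v :: ab_group_add mat \<Rightarrow> 'v mat \<Rightarrow> bool" where
  "mat_orth star absv m n A B \<longleftrightarrow>
     orth (absv (m + n) (m + n)) (sa_dilation star A) (sa_dilation star B)"

end

theory Submission
  imports Defs
begin

text \<open>In an absolutely ordered space let \<open>x\<^sup>+\<close> and \<open>x\<^sup>-\<close> be the halves of
  \<open>\<bar>x\<bar> + x\<close> and \<open>\<bar>x\<bar> - x\<close>. They are positive and orthogonal to each other.
  For positive elements, the axioms on orthogonality (it passes to smaller elements and to
  \<open>\<bar>b \<plusminus> c\<bar>\<close>) imply that \<open>a\<close> is orthogonal to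
  \<open>b + c\<close> exactly when it is orthogonal to \<open>b\<close> and to \<open>c\<close>. Therefore both
  \<open>x \<perp> y\<close> and the two equations \<open>\<bar>x \<plusminus> y\<bar> = \<bar>x\<bar> + \<bar>y\<bar>\<close>
  amount to the same four relations between \<open>x\<^sup>+, x\<^sup>-\<close> and
  \<open>y\<^sup>+, y\<^sup>-\<close>; this is the theorem \<open>orth_iff_absv_add_minus\<close>.

  For matrices, the only consequence of the multiplicative axiom that is needed is that
  \<open>\<bar>\<alpha> A\<bar> = \<bar>A\<bar>\<close> for an isometry \<open>\<alpha>\<close> that permutes rows and
  inserts zero rows (\<open>absv_row_embedding\<close>). Exchanging the block rows of the self-adjoint
  dilation \<open>[0, A; A*, 0]\<close> of \<open>A\<close> yields \<open>A* \<oplus> A\<close>, so its absolute value is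
  \<open>\<bar>A*\<bar> \<oplus> \<bar>A\<bar>\<close>. Applied to the dilations of \<open>u\<close> and \<open>v\<close>, the
  theorem on absolutely ordered spaces gives the first part
  (\<open>mat_orth_iff_absv_add_diff\<close>); it also follows that \<open>u \<perp> v\<close> holds if and only
  if \<open>\<bar>u*\<bar> \<perp> \<bar>v*\<bar>\<close> and \<open>\<bar>u\<bar> \<perp> \<bar>v\<bar>\<close>
  (\<open>mat_orth_iff_absv_absv\<close>).

  For the second part, write \<open>[u; v] = [u; 0] + [0; v]\<close>. Here
  \<open>\<bar>[u; 0]\<bar> = \<bar>u\<bar>\<close> and \<open>\<bar>[0; v]\<bar> = \<bar>v\<bar>\<close>, while the adjoints
  have the absolute values \<open>\<bar>u*\<bar> \<oplus> 0\<close> and \<open>0 \<oplus> \<bar>v*\<bar>\<close>, which are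
  always orthogonal. So the two summands are orthogonal and the first part applies to them. The
  decomposition \<open>[u, v] = [u, 0] + [0, v]\<close> is treated in the same way, with adjoints
  exchanged.\<close>

section \<open>Orthogonality in an absolutely ordered space\<close>

context real_vector_space_on
begin

lemma add_left_commute_on:
  "u \<in> E \<Longrightarrow> v \<in> E \<Longrightarrow> w \<in> E \<Longrightarrow> u + (v + w) = v + (u + w)"
  by (metis add_assoc_on add_commute_on)

lemmas closed_on = zero_closed add_closed uminus_closed smul_closed

lemmas ac_on = add_assoc_on add_commute_on add_left_commute_on

lemma minus_closed: "u \<in> E \<Longrightarrow> v \<in> E \<Longrightarrow> u - v \<in> E"
  by (simp add: minus_on closed_on)

lemma zero_add_on: "u \<in> E \<Longrightarrow> zero + u = u"
  using add_commute_on add_zero_on zero_closed by metis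

lemma add_left_imp_eq_on:
  assumes "u \<in> E" "v \<in> E" "w \<in> E" "u + v = u + w"
  shows "v = w"
proof -
  have *: "- u + (u + x) = x" if "x \<in> E" for x
  proof -
    have "- u + (u + x) = (u + - u) + x"
      using that assms(1) by (simp add: ac_on closed_on)
    then show ?thesis
      using that assms(1) by (simp add: add_uminus_on zero_add_on)
  qed
  show ?thesis
    using *[OF assms(2)] *[OF assms(3)] assms(4) by metis
qed

lemma smul_0_left:
  assumes "u \<in> E" shows "smul 0 u = zero"
proof (rule add_left_imp_eq_on[of "smul 1 u"])
  show "smul 1 u + smul 0 u = smul 1 u + zero"
    using smul_add_left[of u 1 0] assms by (simp add: smul_closed add_zero_on)
qed (use assms closed_on in auto)

lemma smul_minus_1: 
  assumes "u \<in> E" shows "smul (- 1) u = - u"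
proof (rule add_left_imp_eq_on[of u])
  show "u + smul (- 1) u = u + - u"
    using assms smul_add_left[of u 1 "-1"] by (simp add: smul_one smul_0_left add_uminus_on)
qed (use assms closed_on in auto)

lemma smul_zero_right: "smul k zero = zero"
  using smul_0_left[OF zero_closed] smul_smul[OF zero_closed, of k 0] by simp

lemma uminus_uminus_on: "u \<in> E \<Longrightarrow> - (- u) = u"
  using smul_smul[of u "- 1" "- 1"] by (simp add: smul_minus_1 closed_on smul_one)

lemma uminus_add_on: "u \<in> E \<Longrightarrow> v \<in> E \<Longrightarrow> - (u + v) = - u + - v"
  using smul_add_right[of u v "- 1"] by (simp add: smul_minus_1 closed_on)

lemma uminus_minus_on: "u \<in> E \<Longrightarrow> v \<in> E \<Longrightarrow> - (u - v) = v - u"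
  by (simp add: minus_on uminus_add_on uminus_uminus_on closed_on add_commute_on)

lemma add_minus_cancel_on: 
  assumes "u \<in> E" "v \<in> E" shows "(u + v) - u = v"
proof -
  have "(u + v) - u = v + (u + - u)"
    using assms by (simp add: minus_on ac_on closed_on)
  then show ?thesis
    using assms by (simp add: add_uminus_on add_zero_on)
qed

lemma minus_eq_zero_on:
  assumes "u \<in> E" "v \<in> E" "u - v = zero" shows "u = v"
proof -
  have "v + (u - v) = u + (v + - v)"
    using assms(1,2) by (simp add: minus_on ac_on closed_on)
  then show ?thesis
    using assms by (simp add: add_uminus_on add_zero_on)
qed

lemma add_minus_add_on:
  assumes "a \<in> E" "b \<in> E" "c \<in> E" "d \<in> E"
  shows "(a + b) - (c + d) = (a - c) + (b - d)"
  using assms by (simp add: minus_on uminus_add_on ac_on closed_on)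

lemma smul_half_add: "u \<in> E \<Longrightarrow> smul (1/2) u + smul (1/2) u = u"
  using smul_add_left[of u "1/2" "1/2"] by (simp add: smul_one)

lemma smul_uminus: "u \<in> E \<Longrightarrow> smul k (- u) = - smul k u"
  using smul_smul[of u k "- 1"] smul_smul[of u "- 1" k] by (simp add: smul_minus_1 closed_on)

end

context absolutely_ordered_space
begin

lemma cone_imp_carrier: "u \<in> P \<Longrightarrow> u \<in> E"
  using cone_subset by blast

lemma absv_closed: "u \<in> E \<Longrightarrow> absv u \<in> E"
  using absv_in_cone cone_imp_carrier by blast

lemma zero_in_cone: "zero \<in> P"
  using cone_nonempty cone_smul[of _ 0] smul_0_left cone_imp_carrier by fastforce

lemma absv_uminus: "u \<in> E \<Longrightarrow> absv (- u) = absv u"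
  using absv_smul[of u "- 1"] by (simp add: smul_minus_1 smul_one absv_closed)

text \<open>The cone is automatically proper, because the absolute value is the identity on it
  and is even.\<close>

lemma cone_le_antisym:
  assumes "u \<in> E" "v \<in> E" "cone_le P u v" "cone_le P v u"
  shows "u = v"
proof -
  define p where "p = u - v"
  have E: "p \<in> E" and p: "p \<in> P" and n: "- p \<in> P"
    using assms by (simp_all add: p_def cone_le_def uminus_minus_on minus_closed)
  have "p = - p"
    using absv_uminus[OF E] absv_of_cone[OF p] absv_of_cone[OF n] by simp
  then have "p + p = zero"
    using add_uminus_on[OF E] by simp
  then have "p = zero"
    using smul_add_right[OF E E, of "1/2"] smul_half_add[OF E] smul_zero_right by simp
  then show ?thesis
    using assms minus_eq_zero_on p_def by blast
qed

text \<open>Orthogonality of positive elements. On the cone, where the absolute value is the identity,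
  it agrees with \<^term>\<open>orth absv\<close>; dropping the inner absolute values brings it into the form
  used by the axioms.\<close>

definition porth :: "'e \<Rightarrow> 'e \<Rightarrow> bool" where
  "porth u v \<longleftrightarrow> absv (u - v) = u + v"

lemma porth_sym: "u \<in> P \<Longrightarrow> v \<in> P \<Longrightarrow> porth u v \<Longrightarrow> porth v u"
  using absv_uminus[of "u - v"] add_commute_on[of u v]
  by (simp add: porth_def uminus_minus_on minus_closed cone_imp_carrier)

lemma porth_add:
  assumes "u \<in> P" "v \<in> P" "w \<in> P" "porth u v" "porth u w"
  shows "porth u (v + w)"
  using absv_orth_plus[of u v w] absv_of_cone[of "v + w"] assms cone_imp_carrier cone_add
  by (simp add: porth_def)

text \<open>The converse of additivity holds because each summand lies between \<open>0\<close> and the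
  sum.\<close>

lemma porth_addD1:
  assumes "u \<in> P" "v \<in> P" "w \<in> P" "porth u (v + w)"
  shows "porth u v"
proof -
  have "cone_le P zero v"
    using assms zero_add_on[of v] add_minus_cancel_on[of zero v] zero_closed
    by (simp add: cone_le_def cone_imp_carrier)
  moreover have "cone_le P v (v + w)"
    using assms by (simp add: cone_le_def add_minus_cancel_on cone_imp_carrier)
  ultimately show ?thesis
    using absv_orth_mono[of u "v + w" v] assms cone_imp_carrier cone_add
    by (simp add: porth_def)
qed

lemma porth_addD2:
  assumes "u \<in> P" "v \<in> P" "w \<in> P" "porth u (v + w)"
  shows "porth u w"
  using porth_addD1[of u w v] assms add_commute_on[of v w] cone_imp_carrier by simp

lemma porth_add_iff:
  "u \<in> P \<Longrightarrow> v \<in> P \<Longrightarrow> w \<in> P \<Longrightarrow> porth u (v + w) \<longleftrightarrow> porth u v \<and> porth u w"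
  using porth_add porth_addD1 porth_addD2 by blast

lemma porth_commute: "u \<in> P \<Longrightarrow> v \<in> P \<Longrightarrow> porth u v \<longleftrightarrow> porth v u"
  using porth_sym by blast

lemma porth_add_add_iff:
  assumes "a \<in> P" "b \<in> P" "c \<in> P" "d \<in> P"
  shows "porth (a + b) (c + d) \<longleftrightarrow> porth a c \<and> porth a d \<and> porth b c \<and> porth b d"
  using assms porth_commute[of "a + b" c] porth_commute[of "a + b" d] porth_commute[of a c]
    porth_commute[of a d] porth_commute[of b c] porth_commute[of b d]
  by (auto simp add: porth_add_iff cone_add)

text \<open>The positive part \<open>x\<^sup>+\<close>, defined through the absolute value instead of a supremum
  because \<open>E\<close> need not be a lattice.\<close>

definition pos_part :: "'e \<Rightarrow> 'e" where
  "pos_part x = smul (1/2) (absv x + x)"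

text \<open>The negative part of an element, taken to be positive: \<open>x = pos_part x - neg_part x\<close>.\<close>

definition neg_part :: "'e \<Rightarrow> 'e" where
  "neg_part x = smul (1/2) (absv x - x)"

lemma pos_part_in_cone: "x \<in> E \<Longrightarrow> pos_part x \<in> P"
  by (simp add: pos_part_def absv_plus cone_smul)

lemma neg_part_in_cone: "x \<in> E \<Longrightarrow> neg_part x \<in> P"
  by (simp add: neg_part_def absv_minus cone_smul)

lemma pos_part_uminus: "x \<in> E \<Longrightarrow> pos_part (- x) = neg_part x"
  by (simp add: pos_part_def neg_part_def absv_uminus minus_on absv_closed)

lemma neg_part_uminus: "x \<in> E \<Longrightarrow> neg_part (- x) = pos_part x"
  by (simp add: pos_part_def neg_part_def absv_uminus minus_on absv_closed uminus_uminus_on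
      uminus_closed)

lemma pos_part_add_neg_part:
  assumes "x \<in> E" shows "pos_part x + neg_part x = absv x"
proof -
  let ?a = "smul (1/2) (absv x)" and ?x = "smul (1/2) x"
  have "pos_part x + neg_part x = (?a + ?a) + (?x + - ?x)"
    using assms by (simp add: pos_part_def neg_part_def minus_on smul_add_right smul_uminus
        absv_closed ac_on closed_on)
  then show ?thesis
    using assms by (simp add: smul_half_add add_uminus_on add_zero_on absv_closed closed_on)
qed

lemma pos_part_minus_neg_part:
  assumes "x \<in> E" shows "pos_part x - neg_part x = x"
proof -
  let ?a = "smul (1/2) (absv x)" and ?x = "smul (1/2) x"
  have "pos_part x - neg_part x = (?x + ?x) + (?a + - ?a)"
    using assms by (simp add: pos_part_def neg_part_def minus_on smul_add_right smul_uminus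
        uminus_add_on uminus_uminus_on absv_closed ac_on closed_on)
  then show ?thesis
    using assms by (simp add: smul_half_add add_uminus_on add_zero_on absv_closed closed_on)
qed

lemma porth_pos_part_neg_part: "x \<in> E \<Longrightarrow> porth (pos_part x) (neg_part x)"
  by (simp add: porth_def pos_part_add_neg_part pos_part_minus_neg_part)

lemma orth_iff_parts:
  assumes "x \<in> E" "y \<in> E"
  shows "orth absv x y \<longleftrightarrow>
    porth (pos_part x) (pos_part y) \<and> porth (pos_part x) (neg_part y) \<and>
    porth (neg_part x) (pos_part y) \<and> porth (neg_part x) (neg_part y)"
proof -
  have "orth absv x y \<longleftrightarrow> porth (pos_part x + neg_part x) (pos_part y + neg_part y)"
    using assms by (simp add: orth_def porth_def pos_part_add_neg_part)
  then show ?thesis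
    using assms by (simp add: porth_add_add_iff pos_part_in_cone neg_part_in_cone)
qed

text \<open>The equation says that \<open>pos_part x + pos_part y\<close> and
  \<open>neg_part x + neg_part y\<close> are orthogonal: their difference is \<open>x + y\<close> and their sum
  is \<open>absv x + absv y\<close>.\<close>

lemma absv_add_iff_porth:
  assumes "x \<in> E" "y \<in> E"
  shows "absv (x + y) = absv x + absv y \<longleftrightarrow>
    porth (pos_part x) (neg_part y) \<and> porth (neg_part x) (pos_part y)"
proof -
  note cone = pos_part_in_cone neg_part_in_cone
  have "(pos_part x + pos_part y) - (neg_part x + neg_part y) = x + y"
    using assms by (simp add: add_minus_add_on pos_part_minus_neg_part cone cone_imp_carrier)
  moreover have "(pos_part x + pos_part y) + (neg_part x + neg_part y)
      = (pos_part x + neg_part x) + (pos_part y + neg_part y)"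
    using assms by (simp add: ac_on cone cone_imp_carrier closed_on)
  then have "(pos_part x + pos_part y) + (neg_part x + neg_part y) = absv x + absv y"
    using assms by (simp add: pos_part_add_neg_part)
  ultimately have "absv (x + y) = absv x + absv y \<longleftrightarrow>
      porth (pos_part x + pos_part y) (neg_part x + neg_part y)"
    by (simp add: porth_def)
  then show ?thesis
    using assms porth_commute[of "neg_part x" "pos_part y"]
    by (auto simp add: porth_add_add_iff cone porth_pos_part_neg_part)
qed

theorem orth_iff_absv_add_minus:
  assumes "x \<in> E" "y \<in> E"
  shows "orth absv x y \<longleftrightarrow>
    absv (x + y) = absv x + absv y \<and> absv (x - y) = absv x + absv y"
  using absv_add_iff_porth[OF assms] absv_add_iff_porth[of x "- y"] assms
  by (auto simp add: orth_iff_parts minus_on absv_uminus pos_part_uminus neg_part_uminus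
      uminus_closed)

end

section \<open>Block matrices\<close>

lemma mat_star_carrier: "A \<in> carrier_mat m n \<Longrightarrow> mat_star star A \<in> carrier_mat n m"
  by (auto simp add: mat_star_def)

lemma mat_dsum_carrier:
  "A \<in> carrier_mat m n \<Longrightarrow> B \<in> carrier_mat r s \<Longrightarrow> mat_dsum A B \<in> carrier_mat (m + r) (n + s)"
  by (auto simp add: mat_dsum_def)

lemma sa_dilation_carrier:
  "A \<in> carrier_mat m n \<Longrightarrow> sa_dilation star A \<in> carrier_mat (m + n) (m + n)"
  by (auto simp add: sa_dilation_def)

lemma append_cols_carrier:
  "A \<in> carrier_mat m n \<Longrightarrow> B \<in> carrier_mat m s \<Longrightarrow> append_cols A B \<in> carrier_mat m (n + s)"
  by (auto simp add: append_cols_def)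

lemma append_rows_carrier:
  "A \<in> carrier_mat m n \<Longrightarrow> B \<in> carrier_mat r n \<Longrightarrow> append_rows A B \<in> carrier_mat (m + r) n"
  by (auto simp add: append_rows_def)

lemma mat_dsum_add:
  fixes A B :: "'v :: monoid_add mat"
  assumes "A \<in> carrier_mat m n" "A' \<in> carrier_mat m n" "B \<in> carrier_mat r s" "B' \<in> carrier_mat r s"
  shows "mat_dsum A B + mat_dsum A' B' = mat_dsum (A + A') (B + B')"
  by (rule eq_matI) (use assms in \<open>auto simp add: mat_dsum_def\<close>)

lemma mat_dsum_minus:
  fixes A B :: "'v :: group_add mat"
  assumes "A \<in> carrier_mat m n" "A' \<in> carrier_mat m n" "B \<in> carrier_mat r s" "B' \<in> carrier_mat r s"
  shows "mat_dsum A B - mat_dsum A' B' = mat_dsum (A - A') (B - B')"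
  by (rule eq_matI) (use assms in \<open>auto simp add: mat_dsum_def\<close>)

lemma mat_dsum_eq_iff:
  assumes "A \<in> carrier_mat m n" "A' \<in> carrier_mat m n" "B \<in> carrier_mat r s" "B' \<in> carrier_mat r s"
  shows "mat_dsum A B = mat_dsum A' B' \<longleftrightarrow> A = A' \<and> B = B'"
proof
  assume eq: "mat_dsum A B = mat_dsum A' B'"
  have "A $$ (i, j) = A' $$ (i, j)" if "i < m" "j < n" for i j
    using arg_cong[OF eq, of "\<lambda>M. M $$ (i, j)"] that assms by (simp add: mat_dsum_def)
  moreover have "B $$ (i, j) = B' $$ (i, j)" if "i < r" "j < s" for i j
    using arg_cong[OF eq, of "\<lambda>M. M $$ (m + i, n + j)"] that assms by (simp add: mat_dsum_def)
  ultimately show "A = A' \<and> B = B'"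
    using assms by (auto intro!: eq_matI)
qed simp

section \<open>Isometries that insert zero rows\<close>

lemma mat_opnorm_le_1:
  assumes "\<And>x. x \<in> carrier_vec (dim_col \<alpha>) \<Longrightarrow> vec_l2norm (\<alpha> *\<^sub>v x) \<le> vec_l2norm x"
  shows "mat_opnorm \<alpha> \<le> 1"
  unfolding mat_opnorm_def
proof (rule cSUP_least)
  have "0\<^sub>v (dim_col \<alpha>) \<in> {x \<in> carrier_vec (dim_col \<alpha>). vec_l2norm x \<le> 1}"
    by (simp add: vec_l2norm_def L2_set_def)
  then show "{x \<in> carrier_vec (dim_col \<alpha>). vec_l2norm x \<le> 1} \<noteq> {}"
    by blast
qed (use assms in fastforce)

text \<open>The matrix of the linear map from \<open>\<complex>\<^sup>m\<close> to \<open>\<complex>\<^sup>r\<close> that sends the \<open>k\<close>-th unit vector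
  to the \<open>f k\<close>-th one. It is an isometry if \<open>f\<close> maps \<open>{..<m}\<close>
  injectively into \<open>{..<r}\<close>.\<close>

definition row_embedding :: "(nat \<Rightarrow> nat) \<Rightarrow> nat \<Rightarrow> nat \<Rightarrow> complex mat" where
  "row_embedding f r m = mat r m (\<lambda>(i, k). if i = f k then 1 else 0)"

lemma row_embedding_carrier: "row_embedding f r m \<in> carrier_mat r m"
  by (simp add: row_embedding_def)

lemma row_embedding_mult_vec:
  assumes "inj_on f {..<m}" "x \<in> carrier_vec m" "k < m" "f k < r"
  shows "(row_embedding f r m *\<^sub>v x) $ f k = x $ k"
proof -
  have "(row_embedding f r m *\<^sub>v x) $ f k = (\<Sum>l\<in>{0..<m}. (if f k = f l then 1 else 0) * x $ l)"
    using assms by (simp add: row_embedding_def scalar_prod_def)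
  also have "\<dots> = (\<Sum>l\<in>{0..<m}. if l = k then x $ l else 0)"
    using assms by (intro sum.cong) (auto simp add: inj_on_eq_iff)
  finally show ?thesis
    using assms by simp
qed

lemma row_embedding_mult_vec_0:
  assumes "x \<in> carrier_vec m" "i < r" "i \<notin> f ` {..<m}"
  shows "(row_embedding f r m *\<^sub>v x) $ i = 0"
  using assms by (auto simp add: row_embedding_def scalar_prod_def intro!: sum.neutral)

lemma row_embedding_transpose_mult_vec:
  assumes "y \<in> carrier_vec r" "k < m" "f k < r"
  shows "(transpose_mat (row_embedding f r m) *\<^sub>v y) $ k = y $ f k"
proof -
  have "(transpose_mat (row_embedding f r m) *\<^sub>v y) $ k
      = (\<Sum>l\<in>{0..<r}. (if l = f k then 1 else 0) * y $ l)"
    using assms by (simp add: row_embedding_def scalar_prod_def)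
  also have "\<dots> = (\<Sum>l\<in>{0..<r}. if l = f k then y $ l else 0)"
    by (intro sum.cong) auto
  finally show ?thesis
    using assms by simp
qed

lemma mat_opnorm_row_embedding:
  assumes f: "inj_on f {..<m}" "f ` {..<m} \<subseteq> {..<r}"
  shows "mat_opnorm (row_embedding f r m) \<le> 1"
proof (rule mat_opnorm_le_1)
  fix x :: "complex vec" assume "x \<in> carrier_vec (dim_col (row_embedding f r m))"
  then have x: "x \<in> carrier_vec m"
    by (simp add: row_embedding_def)
  let ?y = "row_embedding f r m *\<^sub>v x"
  have "(\<Sum>i<r. (cmod (?y $ i))\<^sup>2) = (\<Sum>i\<in>f ` {..<m}. (cmod (?y $ i))\<^sup>2)"
    using f row_embedding_mult_vec_0[OF x] by (intro sum.mono_neutral_right) auto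
  also have "\<dots> = (\<Sum>k<m. (cmod (x $ k))\<^sup>2)"
    using f row_embedding_mult_vec[OF f(1) x]
    by (auto simp add: sum.reindex image_subset_iff intro!: sum.cong)
  finally show "vec_l2norm ?y \<le> vec_l2norm x"
    using x by (simp add: vec_l2norm_def L2_set_def row_embedding_def)
qed

lemma mat_opnorm_row_embedding_transpose:
  assumes f: "inj_on f {..<m}" "f ` {..<m} \<subseteq> {..<r}"
  shows "mat_opnorm (transpose_mat (row_embedding f r m)) \<le> 1"
proof (rule mat_opnorm_le_1)
  fix y :: "complex vec" assume "y \<in> carrier_vec (dim_col (transpose_mat (row_embedding f r m)))"
  then have y: "y \<in> carrier_vec r"
    by (simp add: row_embedding_def)
  let ?x = "transpose_mat (row_embedding f r m) *\<^sub>v y"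
  have "(\<Sum>k<m. (cmod (?x $ k))\<^sup>2) = (\<Sum>k<m. (cmod (y $ f k))\<^sup>2)"
    using f row_embedding_transpose_mult_vec[OF y]
    by (auto simp add: image_subset_iff intro!: sum.cong)
  also have "\<dots> = (\<Sum>i\<in>f ` {..<m}. (cmod (y $ i))\<^sup>2)"
    using f by (simp add: sum.reindex)
  also have "\<dots> \<le> (\<Sum>i<r. (cmod (y $ i))\<^sup>2)"
    using f by (intro sum_mono2) auto
  finally show "vec_l2norm ?x \<le> vec_l2norm y"
    using y by (simp add: vec_l2norm_def L2_set_def row_embedding_def)
qed

section \<open>Absolute values of block matrices\<close>

context star_vector_space
begin

lemma star_0: "star 0 = 0"
  using star_add[of 0 0] by simp

lemma star_diff: "star (x - y) = star x - star y"
  using star_add[of "x - y" y] by simp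

lemma mat_star_add:
  "A \<in> carrier_mat m n \<Longrightarrow> B \<in> carrier_mat m n \<Longrightarrow>
    mat_star star (A + B) = mat_star star A + mat_star star B"
  by (rule eq_matI) (auto simp add: mat_star_def star_add)

lemma mat_star_diff:
  "A \<in> carrier_mat m n \<Longrightarrow> B \<in> carrier_mat m n \<Longrightarrow>
    mat_star star (A - B) = mat_star star A - mat_star star B"
  by (rule eq_matI) (auto simp add: mat_star_def star_diff)

lemma sa_dilation_in_sa_mats:
  "A \<in> carrier_mat m n \<Longrightarrow> sa_dilation star A \<in> sa_mats star (m + n)"
  by (auto simp add: sa_mats_def sa_dilation_carrier intro!: eq_matI)
    (auto simp add: mat_star_def sa_dilation_def star_0 star_star)

lemma sa_dilation_add:
  assumes "A \<in> carrier_mat m n" "B \<in> carrier_mat m n"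
  shows "sa_dilation star (A + B) = sa_dilation star A + sa_dilation star B"
  by (rule eq_matI) (use assms in \<open>auto simp add: sa_dilation_def mat_star_def star_add\<close>)

lemma sa_dilation_diff:
  assumes "A \<in> carrier_mat m n" "B \<in> carrier_mat m n"
  shows "sa_dilation star (A - B) = sa_dilation star A - sa_dilation star B"
  by (rule eq_matI) (use assms in \<open>auto simp add: sa_dilation_def mat_star_def star_diff\<close>)

lemma scale_if: "scale (if b then 1 else 0) x = (if b then x else 0)"
  by simp

lemma mat_rmul_one: "mat_rmul scale A (1\<^sub>m (dim_col A)) = A"
proof (rule eq_matI)
  fix i j assume ij: "i < dim_row A" "j < dim_col A"
  have "mat_rmul scale A (1\<^sub>m (dim_col A)) $$ (i, j)
      = (\<Sum>k<dim_col A. if k = j then A $$ (i, k) else 0)"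
    using ij by (simp add: mat_rmul_def scale_if)
  then show "mat_rmul scale A (1\<^sub>m (dim_col A)) $$ (i, j) = A $$ (i, j)"
    using ij by simp
qed (simp_all add: mat_rmul_def)

lemma mat_lmul_row_embedding:
  assumes "A \<in> carrier_mat m n" "B \<in> carrier_mat r n"
    and "inj_on f {..<m}" "f ` {..<m} \<subseteq> {..<r}"
    and "\<And>k j. k < m \<Longrightarrow> j < n \<Longrightarrow> B $$ (f k, j) = A $$ (k, j)"
    and "\<And>i j. i < r \<Longrightarrow> i \<notin> f ` {..<m} \<Longrightarrow> j < n \<Longrightarrow> B $$ (i, j) = 0"
  shows "mat_lmul scale (row_embedding f r m) A = B"
proof (rule eq_matI)
  fix i j assume "i < dim_row B" "j < dim_col B"
  then have ij: "i < r" "j < n"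
    using assms by auto
  have *: "mat_lmul scale (row_embedding f r m) A $$ (i, j)
      = (\<Sum>k<m. if i = f k then A $$ (k, j) else 0)"
    using ij assms by (simp add: mat_lmul_def row_embedding_def scale_if)
  show "mat_lmul scale (row_embedding f r m) A $$ (i, j) = B $$ (i, j)"
  proof (cases "i \<in> f ` {..<m}")
    case True
    then obtain k where k: "k < m" "i = f k"
      by auto
    have "(\<Sum>l<m. if i = f l then A $$ (l, j) else 0) = (\<Sum>l<m. if l = k then A $$ (l, j) else 0)"
      using k assms(3) by (auto simp add: inj_on_eq_iff intro!: sum.cong)
    then show ?thesis
      using * k ij assms(5) by simp
  next
    case False
    then have "(\<Sum>l<m. if i = f l then A $$ (l, j) else 0) = 0"
      by (intro sum.neutral) auto
    then show ?thesis
      using * False ij assms(6) by simp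
  qed
qed (use assms in \<open>auto simp add: mat_lmul_def row_embedding_def\<close>)

lemma mat_lmul_row_embedding_transpose:
  assumes "A \<in> carrier_mat m n" "B \<in> carrier_mat r n"
    and "f ` {..<m} \<subseteq> {..<r}"
    and "\<And>k j. k < m \<Longrightarrow> j < n \<Longrightarrow> B $$ (f k, j) = A $$ (k, j)"
  shows "mat_lmul scale (transpose_mat (row_embedding f r m)) B = A"
proof (rule eq_matI)
  fix k j assume "k < dim_row A" "j < dim_col A"
  then have kj: "k < m" "j < n" "f k < r"
    using assms by auto
  have "mat_lmul scale (transpose_mat (row_embedding f r m)) B $$ (k, j)
      = (\<Sum>i<r. if i = f k then B $$ (i, j) else 0)"
    using kj assms(1-3) by (simp add: mat_lmul_def row_embedding_def scale_if)
  then show "mat_lmul scale (transpose_mat (row_embedding f r m)) B $$ (k, j) = A $$ (k, j)"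
    using kj assms(4) by simp
qed (use assms in \<open>auto simp add: mat_lmul_def row_embedding_def\<close>)

end

context absolutely_matrix_ordered_space
begin

lemma absv_carrier:
  assumes "m \<ge> 1" "n \<ge> 1" "A \<in> carrier_mat m n"
  shows "absv m n A \<in> carrier_mat n n"
proof -
  interpret N: absolutely_ordered_space "sa_mats star n" "0\<^sub>m n n" "mat_rscale scale" "P n" "absv n n"
    using absv_square assms(2) by blast
  show ?thesis
    using absv_cone[OF assms] N.cone_subset by (auto simp add: sa_mats_def)
qed

lemma absv_zero_square:
  assumes "n \<ge> 1" shows "absv n n (0\<^sub>m n n) = 0\<^sub>m n n"
proof -
  interpret N: absolutely_ordered_space "sa_mats star n" "0\<^sub>m n n" "mat_rscale scale" "P n" "absv n n"
    using absv_square assms by blast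
  show ?thesis
    using N.absv_of_cone N.zero_in_cone by blast
qed

text \<open>Multiplication from the left by a contraction does not increase the absolute value. The
  multiplicative axiom is used with the unit matrix on the right.\<close>

lemma absv_lmul_le:
  assumes "m \<ge> 1" "n \<ge> 1" "r \<ge> 1" "A \<in> carrier_mat m n" "\<alpha> \<in> carrier_mat r m"
    and "mat_opnorm \<alpha> \<le> 1"
  shows "cone_le (P n) (absv r n (mat_lmul scale \<alpha> A)) (absv m n A)"
proof -
  interpret N: absolutely_ordered_space "sa_mats star n" "0\<^sub>m n n" "mat_rscale scale" "P n" "absv n n"
    using absv_square assms(2) by blast
  let ?c = "mat_opnorm \<alpha>" and ?a = "absv m n A" and ?b = "absv r n (mat_lmul scale \<alpha> A)"
  have lmul: "mat_lmul scale \<alpha> A \<in> carrier_mat r n"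
    using assms by (simp add: mat_lmul_def)
  have a: "?a \<in> P n" "?a \<in> carrier_mat n n" and b: "?b \<in> carrier_mat n n"
    using assms lmul absv_cone absv_carrier by auto
  have "cone_le (P n) ?b (mat_rscale scale ?c ?a)"
    using absv_mult[OF assms(1-3,2,4,5) one_carrier_mat] mat_rmul_one[of "mat_lmul scale \<alpha> A"]
      mat_rmul_one[of ?a] lmul a N.absv_of_cone by simp
  then have "mat_rscale scale ?c ?a - ?b \<in> P n"
    by (simp add: cone_le_def)
  moreover have "mat_rscale scale (1 - ?c) ?a \<in> P n"
    using N.cone_smul a assms(6) by simp
  ultimately have "mat_rscale scale (1 - ?c) ?a + (mat_rscale scale ?c ?a - ?b) \<in> P n"
    by (rule N.cone_add[rotated])
  moreover have "mat_rscale scale (1 - ?c) ?a + (mat_rscale scale ?c ?a - ?b) = ?a - ?b"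
    by (rule eq_matI) (use a b in \<open>auto simp add: mat_rscale_def scale_left_diff_distrib\<close>)
  ultimately show ?thesis
    by (simp add: cone_le_def)
qed

text \<open>The absolute value does not change when zero rows are inserted and rows are permuted:
  \<open>B\<close> is the product of a contraction and \<open>A\<close>, and \<open>A\<close> is the product of the
  transposed contraction and \<open>B\<close>.\<close>

lemma absv_row_embedding:
  assumes "m \<ge> 1" "n \<ge> 1" "r \<ge> 1" "A \<in> carrier_mat m n" "B \<in> carrier_mat r n"
    and "inj_on f {..<m}" "f ` {..<m} \<subseteq> {..<r}"
    and "\<And>k j. k < m \<Longrightarrow> j < n \<Longrightarrow> B $$ (f k, j) = A $$ (k, j)"
    and "\<And>i j. i < r \<Longrightarrow> i \<notin> f ` {..<m} \<Longrightarrow> j < n \<Longrightarrow> B $$ (i, j) = 0"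
  shows "absv r n B = absv m n A"
proof -
  interpret N: absolutely_ordered_space "sa_mats star n" "0\<^sub>m n n" "mat_rscale scale" "P n" "absv n n"
    using absv_square assms(2) by blast
  let ?\<alpha> = "row_embedding f r m"
  have AB: "mat_lmul scale ?\<alpha> A = B"
    by (rule mat_lmul_row_embedding) (fact assms)+
  have BA: "mat_lmul scale (transpose_mat ?\<alpha>) B = A"
    by (rule mat_lmul_row_embedding_transpose) (fact assms)+
  have "cone_le (P n) (absv r n B) (absv m n A)"
    using absv_lmul_le[OF assms(1-4) row_embedding_carrier mat_opnorm_row_embedding[OF assms(6,7)]]
    unfolding AB .
  moreover have "transpose_mat ?\<alpha> \<in> carrier_mat m r"
    using row_embedding_carrier by simp
  then have "cone_le (P n) (absv m n A) (absv r n B)"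
    using absv_lmul_le[OF assms(3,2,1,5) _ mat_opnorm_row_embedding_transpose[OF assms(6,7)]]
    unfolding BA by blast
  moreover have "absv m n A \<in> sa_mats star n" "absv r n B \<in> sa_mats star n"
    using absv_cone[OF assms(1,2,4)] absv_cone[OF assms(3,2,5)] N.cone_imp_carrier by auto
  ultimately show ?thesis
    using N.cone_le_antisym by blast
qed

lemma absv_append_rows_zero:
  assumes "m \<ge> 1" "n \<ge> 1" "A \<in> carrier_mat m n"
  shows "absv (m + r) n (append_rows A (0\<^sub>m r n)) = absv m n A"
  by (rule absv_row_embedding[where f = "\<lambda>k. k"])
    (use assms in \<open>auto simp add: append_rows_def\<close>)

lemma absv_append_zero_rows:
  assumes "m \<ge> 1" "n \<ge> 1" "A \<in> carrier_mat m n"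
  shows "absv (r + m) n (append_rows (0\<^sub>m r n) A) = absv m n A"
proof (rule absv_row_embedding[where f = "\<lambda>k. r + k"])
  fix i j assume "i < r + m" "i \<notin> (\<lambda>k. r + k) ` {..<m}" "j < n"
  moreover from this have "i < r"
    by (metis add_diff_inverse_nat image_eqI lessThan_iff nat_add_left_cancel_less)
  ultimately show "append_rows (0\<^sub>m r n) A $$ (i, j) = 0"
    using assms by (simp add: append_rows_def)
qed (use assms in \<open>auto simp add: append_rows_def\<close>)

lemma absv_zero:
  assumes "m \<ge> 1" "n \<ge> 1" shows "absv m n (0\<^sub>m m n) = 0\<^sub>m n n"
proof -
  \<comment> \<open>Both matrices arise from one zero row by appending zero rows.\<close>
  have "absv r n (0\<^sub>m r n) = absv 1 n (0\<^sub>m 1 n)" if "r \<ge> 1" for r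
    by (rule absv_row_embedding[where f = "\<lambda>k. k"]) (use assms that in auto)
  then show ?thesis
    using absv_zero_square[OF assms(2)] assms by metis
qed

text \<open>Zero columns, unlike zero rows, enlarge the absolute value. Adding a zero row as well turns
  the matrix into a direct sum with a zero block.\<close>

lemma absv_append_cols_zero:
  assumes "m \<ge> 1" "n \<ge> 1" "s \<ge> 1" "A \<in> carrier_mat m n"
  shows "absv m (n + s) (append_cols A (0\<^sub>m m s)) = mat_dsum (absv m n A) (0\<^sub>m s s)"
proof -
  have "append_rows (append_cols A (0\<^sub>m m s)) (0\<^sub>m 1 (n + s)) = mat_dsum A (0\<^sub>m 1 s)"
    by (rule eq_matI) (use assms in \<open>auto simp add: append_rows_def append_cols_def mat_dsum_def\<close>)
  then have "absv m (n + s) (append_cols A (0\<^sub>m m s)) = absv (m + 1) (n + s) (mat_dsum A (0\<^sub>m 1 s))"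
    using absv_append_rows_zero[of m "n + s" "append_cols A (0\<^sub>m m s)" 1] assms
      append_cols_carrier[of A m n "0\<^sub>m m s" s] by simp
  also have "\<dots> = mat_dsum (absv m n A) (0\<^sub>m s s)"
    using assms absv_dsum[of m n 1 s A "0\<^sub>m 1 s"] by (simp add: absv_zero)
  finally show ?thesis .
qed

lemma absv_append_zero_cols:
  assumes "m \<ge> 1" "n \<ge> 1" "s \<ge> 1" "A \<in> carrier_mat m n"
  shows "absv m (s + n) (append_cols (0\<^sub>m m s) A) = mat_dsum (0\<^sub>m s s) (absv m n A)"
proof -
  have "append_rows (0\<^sub>m 1 (s + n)) (append_cols (0\<^sub>m m s) A) = mat_dsum (0\<^sub>m 1 s) A"
    by (rule eq_matI) (use assms in \<open>auto simp add: append_rows_def append_cols_def mat_dsum_def\<close>)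
  then have "absv m (s + n) (append_cols (0\<^sub>m m s) A) = absv (1 + m) (s + n) (mat_dsum (0\<^sub>m 1 s) A)"
    using absv_append_zero_rows[of m "s + n" "append_cols (0\<^sub>m m s) A" 1] assms
      append_cols_carrier[of "0\<^sub>m m s" m s A n] by simp
  also have "\<dots> = mat_dsum (0\<^sub>m s s) (absv m n A)"
    using assms absv_dsum[of 1 s m n "0\<^sub>m 1 s" A] by (simp add: absv_zero)
  finally show ?thesis .
qed

text \<open>Exchanging the two block rows of the dilation turns it into a direct sum.\<close>

lemma absv_sa_dilation:
  assumes "m \<ge> 1" "n \<ge> 1" "A \<in> carrier_mat m n"
  shows "absv (m + n) (m + n) (sa_dilation star A)
    = mat_dsum (absv n m (mat_star star A)) (absv m n A)"
proof -
  note star = mat_star_carrier[OF assms(3), of star]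
  have "absv (m + n) (m + n) (sa_dilation star A)
      = absv (n + m) (m + n) (mat_dsum (mat_star star A) A)"
  proof (rule absv_row_embedding[where f = "\<lambda>k. if k < n then m + k else k - n"])
    fix i j assume "i < m + n" "i \<notin> (\<lambda>k. if k < n then m + k else k - n) ` {..<n + m}"
    \<comment> \<open>The block exchange is onto, so no zero row is inserted.\<close>
    moreover from this have "i \<in> (\<lambda>k. if k < n then m + k else k - n) ` {..<n + m}"
      by (intro image_eqI[of _ _ "if i < m then n + i else i - m"]) (auto split: if_splits)
    ultimately show "sa_dilation star A $$ (i, j) = 0"
      by blast
  qed (use assms star carrier_matD[OF star] in
      \<open>auto simp add: sa_dilation_carrier mat_dsum_carrier sa_dilation_def mat_dsum_def inj_on_def\<close>)
  then show ?thesis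
    using assms star by (simp add: absv_dsum)
qed

section \<open>Orthogonality of rectangular matrices\<close>

lemma mat_orth_iff_absv_absv:
  assumes "m \<ge> 1" "n \<ge> 1" "A \<in> carrier_mat m n" "B \<in> carrier_mat m n"
  shows "mat_orth star absv m n A B \<longleftrightarrow>
    absv m m (absv n m (mat_star star A) - absv n m (mat_star star B))
      = absv n m (mat_star star A) + absv n m (mat_star star B) \<and>
    absv n n (absv m n A - absv m n B) = absv m n A + absv m n B"
proof -
  let ?a = "absv m n A" and ?b = "absv m n B"
  let ?c = "absv n m (mat_star star A)" and ?d = "absv n m (mat_star star B)"
  have carr: "?a \<in> carrier_mat n n" "?b \<in> carrier_mat n n" "?c \<in> carrier_mat m m"
    "?d \<in> carrier_mat m m"
    using assms by (auto intro!: absv_carrier mat_star_carrier)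
  then have "absv m m (?c - ?d) \<in> carrier_mat m m" "absv n n (?a - ?b) \<in> carrier_mat n n"
    using assms by (auto intro!: absv_carrier)
  with carr show ?thesis
    using assms by (simp add: mat_orth_def orth_def absv_sa_dilation
        mat_dsum_minus[of _ m m _ _ n n] minus_carrier_mat
        mat_dsum_add[of _ m m _ _ n n] absv_dsum mat_dsum_eq_iff[of _ m m _ _ n n])
qed

lemma mat_orth_iff_absv_add_diff:
  assumes "m \<ge> 1" "n \<ge> 1" "A \<in> carrier_mat m n" "B \<in> carrier_mat m n"
  shows "mat_orth star absv m n A B \<longleftrightarrow>
    absv m n (A + B) = absv m n A + absv m n B \<and>
    absv m n (A - B) = absv m n A + absv m n B \<and>
    absv n m (mat_star star A + mat_star star B)
      = absv n m (mat_star star A) + absv n m (mat_star star B) \<and>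
    absv n m (mat_star star A - mat_star star B)
      = absv n m (mat_star star A) + absv n m (mat_star star B)"
proof -
  have mn: "m + n \<ge> 1"
    using assms by simp
  interpret N: absolutely_ordered_space "sa_mats star (m + n)" "0\<^sub>m (m + n) (m + n)"
    "mat_rscale scale" "P (m + n)" "absv (m + n) (m + n)"
    using absv_square mn by blast
  have dil: "absv (m + n) (m + n) (sa_dilation star C)
      = absv (m + n) (m + n) (sa_dilation star A) + absv (m + n) (m + n) (sa_dilation star B) \<longleftrightarrow>
      absv n m (mat_star star C) = absv n m (mat_star star A) + absv n m (mat_star star B) \<and>
      absv m n C = absv m n A + absv m n B" if C: "C \<in> carrier_mat m n" for C
  proof -
    have carr: "absv m n X \<in> carrier_mat n n" "absv n m (mat_star star X) \<in> carrier_mat m m"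
      if "X \<in> carrier_mat m n" for X
      using assms that by (auto intro!: absv_carrier mat_star_carrier)
    show ?thesis
      using assms C carr[OF C] carr[OF assms(3)] carr[OF assms(4)]
      by (simp add: absv_sa_dilation mat_dsum_add[of _ m m _ _ n n]
          mat_dsum_eq_iff[of _ m m _ _ n n])
  qed
  have "A + B \<in> carrier_mat m n" "A - B \<in> carrier_mat m n"
    using assms by auto
  then show ?thesis
    using N.orth_iff_absv_add_minus[of "sa_dilation star A" "sa_dilation star B"]
      dil[of "A + B"] dil[of "A - B"] assms sa_dilation_in_sa_mats
    by (auto simp add: mat_orth_def sa_dilation_add sa_dilation_diff mat_star_add mat_star_diff)
qed

text \<open>Positive elements in complementary diagonal corners are orthogonal.\<close>

lemma absv_diff_dsum_zero:
  assumes "m \<ge> 1" "n \<ge> 1" "a \<in> P m" "b \<in> P n"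
  shows "absv (m + n) (m + n) (mat_dsum a (0\<^sub>m n n) - mat_dsum (0\<^sub>m m m) b)
    = mat_dsum a (0\<^sub>m n n) + mat_dsum (0\<^sub>m m m) b"
proof -
  interpret M: absolutely_ordered_space "sa_mats star m" "0\<^sub>m m m" "mat_rscale scale" "P m" "absv m m"
    using absv_square assms(1) by blast
  interpret N: absolutely_ordered_space "sa_mats star n" "0\<^sub>m n n" "mat_rscale scale" "P n" "absv n n"
    using absv_square assms(2) by blast
  have carr: "a \<in> carrier_mat m m" "b \<in> carrier_mat n n"
    using assms M.cone_subset N.cone_subset by (auto simp add: sa_mats_def)
  have b: "0\<^sub>m n n - b = - b"
    by (rule eq_matI) (use carr in auto)
  have "a - 0\<^sub>m m m = a" "a + 0\<^sub>m m m = a" "0\<^sub>m n n + b = b"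
    by (rule eq_matI; use carr in auto)+
  moreover have "absv n n (- b) = b"
    using N.absv_uminus[of b] N.cone_imp_carrier[of b] N.absv_of_cone[of b] assms by simp
  ultimately show ?thesis
    using carr assms b
    by (simp add: mat_dsum_minus[of _ m m _ _ n n] minus_carrier_mat
        mat_dsum_add[of _ m m _ _ n n] absv_dsum
        M.absv_of_cone)
qed

text \<open>The adjoints of \<open>[A; 0]\<close> and \<open>[0; B]\<close> have orthogonal absolute values for all
  \<open>A\<close> and \<open>B\<close>, so only the second of the two conditions in
  \<open>mat_orth_iff_absv_absv\<close> is needed; for \<open>append_cols\<close> it is the first one.\<close>

lemma absv_append_rows:
  assumes "m \<ge> 1" "n \<ge> 1" "A \<in> carrier_mat m n" "B \<in> carrier_mat m n"
    and orth: "absv n n (absv m n A - absv m n B) = absv m n A + absv m n B"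
  shows "absv (m + m) n (append_rows A B) = absv m n A + absv m n B"
proof -
  let ?X = "append_rows A (0\<^sub>m m n)" and ?Y = "append_rows (0\<^sub>m m n) B"
  have X: "?X \<in> carrier_mat (m + m) n" and Y: "?Y \<in> carrier_mat (m + m) n"
    using assms by (auto intro: append_rows_carrier)
  have star: "mat_star star ?X = append_cols (mat_star star A) (0\<^sub>m n m)"
    "mat_star star ?Y = append_cols (0\<^sub>m n m) (mat_star star B)"
    by (rule eq_matI; use assms in
      \<open>auto simp add: append_rows_def append_cols_def mat_star_def star_0\<close>)+
  have "mat_star star A \<in> carrier_mat n m" "mat_star star B \<in> carrier_mat n m"
    using assms by (auto intro!: mat_star_carrier)
  then have "mat_orth star absv (m + m) n ?X ?Y"
    using X Y star assms mat_orth_iff_absv_absv[of "m + m" n ?X ?Y]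
    by (simp add: absv_append_cols_zero absv_append_zero_cols absv_append_rows_zero
        absv_append_zero_rows absv_diff_dsum_zero absv_cone orth)
  then have "absv (m + m) n (?X + ?Y) = absv m n A + absv m n B"
    using X Y assms mat_orth_iff_absv_add_diff[of "m + m" n ?X ?Y]
    by (simp add: absv_append_rows_zero absv_append_zero_rows)
  moreover have "?X + ?Y = append_rows A B"
    by (rule eq_matI) (use assms in \<open>auto simp add: append_rows_def\<close>)
  ultimately show ?thesis
    by simp
qed

lemma absv_append_cols:
  assumes "m \<ge> 1" "n \<ge> 1" "A \<in> carrier_mat m n" "B \<in> carrier_mat m n"
    and orth: "absv m m (absv n m (mat_star star A) - absv n m (mat_star star B))
      = absv n m (mat_star star A) + absv n m (mat_star star B)"
  shows "absv m (n + n) (append_cols A B) = mat_dsum (absv m n A) (absv m n B)"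
proof -
  let ?X = "append_cols A (0\<^sub>m m n)" and ?Y = "append_cols (0\<^sub>m m n) B"
  have X: "?X \<in> carrier_mat m (n + n)" and Y: "?Y \<in> carrier_mat m (n + n)"
    using assms by (auto intro: append_cols_carrier)
  have star: "mat_star star ?X = append_rows (mat_star star A) (0\<^sub>m n m)"
    "mat_star star ?Y = append_rows (0\<^sub>m n m) (mat_star star B)"
    by (rule eq_matI; use assms in
      \<open>auto simp add: append_rows_def append_cols_def mat_star_def star_0\<close>)+
  have "mat_star star A \<in> carrier_mat n m" "mat_star star B \<in> carrier_mat n m"
    using assms by (auto intro!: mat_star_carrier)
  then have "mat_orth star absv m (n + n) ?X ?Y"
    using X Y star assms mat_orth_iff_absv_absv[of m "n + n" ?X ?Y]
    by (simp add: absv_append_cols_zero absv_append_zero_cols absv_append_rows_zero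
        absv_append_zero_rows absv_diff_dsum_zero absv_cone orth)
  then have "absv m (n + n) (?X + ?Y)
      = mat_dsum (absv m n A) (0\<^sub>m n n) + mat_dsum (0\<^sub>m n n) (absv m n B)"
    using X Y assms mat_orth_iff_absv_add_diff[of m "n + n" ?X ?Y]
    by (simp add: absv_append_cols_zero absv_append_zero_cols)
  moreover have "\<dots> = mat_dsum (absv m n A) (absv m n B)"
    using absv_carrier[OF assms(1,2,3)] absv_carrier[OF assms(1,2,4)]
    by (simp add: mat_dsum_add[of _ n n _ _ n n])
  moreover have "?X + ?Y = append_cols A B"
    by (rule eq_matI) (use assms in \<open>auto simp add: append_cols_def\<close>)
  ultimately show ?thesis
    by simp
qed

end

theorem proposition2p8:
  fixes scale :: "complex \<Rightarrow> 'v \<Rightarrow> 'v :: ab_group_add"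
    and star :: "'v \<Rightarrow> 'v"
    and P :: "nat \<Rightarrow> 'v mat set"
    and absv :: "nat \<Rightarrow> nat \<Rightarrow> 'v mat \<Rightarrow> 'v mat"
    and m n :: nat
    and u v :: "'v mat"
  assumes "absolutely_matrix_ordered_space scale star P absv"
    and "m \<ge> 1" and "n \<ge> 1"
    and "u \<in> carrier_mat m n" and "v \<in> carrier_mat m n"
  shows "(mat_orth star absv m n u v \<longleftrightarrow>
            absv m n (u + v) = absv m n u + absv m n v \<and>
            absv m n (u - v) = absv m n u + absv m n v \<and>
            absv n m (mat_star star u + mat_star star v)
              = absv n m (mat_star star u) + absv n m (mat_star star v) \<and>
            absv n m (mat_star star u - mat_star star v)
              = absv n m (mat_star star u) + absv n m (mat_star star v))
       \<and> (mat_orth star absv m n u v \<longrightarrow>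
            absv (2 * m) n (append_rows u v) = absv m n u + absv m n v \<and>
            absv m (2 * n) (append_cols u v) = mat_dsum (absv m n u) (absv m n v))"
proof -
  interpret absolutely_matrix_ordered_space scale star P absv
    by (fact assms(1))
  show ?thesis
    using mat_orth_iff_absv_add_diff[OF assms(2-5)] mat_orth_iff_absv_absv[OF assms(2-5)]
      absv_append_rows[OF assms(2-5)] absv_append_cols[OF assms(2-5)]
    unfolding mult_2 by blast
qed

end
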